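(* Let $G=G^{(0)}$ be a signed graph on $n>1$ nodes with canonical marking, having $n_+$ positively marked and $n_-$ negatively marked nodes, and let $G^{(m)}$, $m\ge1$, be the signed corona graph generated by $G$. For a node $v$ of $G^{(0)}$, let $d_0^+(v),d_0^-(v)$ be its positive and negative degree in $G^{(0)}$ and $\mu(v)$ its canonical marking in $G^{(0)}$. Then its positive degree $d^+(v)$ and negative degree $d^-(v)$ in $G^{(m)}$ are: (1) if $n_+,n_-$ are both odd: for $m$ even (either marking), $d^+(v)=d_0^+(v)+\frac m2(n_++n_-)$, $d^-(v)=d_0^-(v)+\frac m2(n_++n_-)$; for $m$ odd and $\mu(v)=+$, $d^+(v)=d_0^+(v)+\frac{m+1}{2}n_++\frac{m-1}{2}n_-$, $d^-(v)=d_0^-(v)+\frac{m+1}{2}n_-+\frac{m-1}{2}n_+$; for $m$ odd and $\mu(v)=-$, $d^+(v)=d_0^+(v)+\frac{m+1}{2}n_-+\frac{m-1}{2}n_+$, $d^-(v)=d_0^-(v)+\frac{m+1}{2}n_++\frac{m-1}{2}n_-$; (2) if $n_+$ is even and $n_-$ odd: if $\mu(v)=+$, $d^+(v)=d_0^+(v)+n_++(m-1)n_-$, $d^-(v)=d_0^-(v)+n_-+(m-1)n_+$; if $\mu(v)=-$, $d^+(v)=d_0^+(v)+mn_-$, $d^-(v)=d_0^-(v)+mn_+$; (3) if $n_+,n_-$ are both even: if $\mu(v)=+$, $d^+(v)=d_0^+(v)+mn_+$, $d^-(v)=d_0^-(v)+mn_-$; if $\mu(v)=-$, $d^+(v)=d_0^+(v)+mn_-$,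 $d^-(v)=d_0^-(v)+mn_+$; (4) if $n_+$ is odd and $n_-$ even: if $\mu(v)=+$, $d^+(v)=d_0^+(v)+mn_+$, $d^-(v)=d_0^-(v)+mn_-$; if $\mu(v)=-$, $d^+(v)=d_0^+(v)+n_-+(m-1)n_+$, $d^-(v)=d_0^-(v)+n_++(m-1)n_-$.
   Context: A signed graph has edges signed $+$ or $-$; $d^\pm(v)$ are the numbers of positive/negative edges at $v$. The canonical marking of a node $v$ is $\mu(v)=\prod_{e\ni v}\sigma(e)$, the product of the signs of all edges incident to $v$ (so $\mu(v)=+$ iff $d^-(v)$ is even). Corona product of signed graphs $H_1$ (nodes $u_1,\dots,u_N$) and $H_2$, each canonically marked: take one copy of $H_1$ and $N$ copies of $H_2$ and join $u_i$ to every node of the $i$-th copy of $H_2$, the edge from $u_i$ to the copy of $w$ having sign $\mu_{H_1}(u_i)\mu_{H_2}(w)$. Signed corona graphs generated by the seed graph $G$: $G^{(0)}=G$ and $G^{(m)}=G^{(m-1)}\circ G$ for $m\ge1$, where at each step $G^{(m-1)}$ carries its own canonical marking (as a signed graph) and $G$ its canonical marking. The nodes of $G^{(0)}$ are regarded as nodes of every $G^{(m)}$. *)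

theory Defs
  imports Main
begin

text \<open>Finite simple undirected graphs: an edge is a two-element set of nodes, and the sign of
  an edge is \<open>1\<close> or \<open>-1\<close>. The value of \<open>edge_sign\<close> off the edge set is irrelevant.\<close>

record 'a signed_graph =
  nodes :: "'a set"
  edges :: "'a set set"
  edge_sign :: "'a set \<Rightarrow> int"

definition wf_signed_graph :: "'a signed_graph \<Rightarrow> bool" where
  "wf_signed_graph G \<longleftrightarrow>
     finite (nodes G) \<and>
     (\<forall>e \<in> edges G. e \<subseteq> nodes G \<and> card e = 2) \<and>
     (\<forall>e \<in> edges G. edge_sign G e = 1 \<or> edge_sign G e = -1)"

definition pos_degree :: "'a signed_graph \<Rightarrow> 'a \<Rightarrow> nat" where
  "pos_degree G v = card {e \<in> edges G. v \<in> e \<and> edge_sign G e = 1}"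

definition neg_degree :: "'a signed_graph \<Rightarrow> 'a \<Rightarrow> nat" where
  "neg_degree G v = card {e \<in> edges G. v \<in> e \<and> edge_sign G e = -1}"

definition canonical_marking :: "'a signed_graph \<Rightarrow> 'a \<Rightarrow> int" where
  "canonical_marking G v = (\<Prod>e \<in> {e \<in> edges G. v \<in> e}. edge_sign G e)"

definition num_pos_marked :: "'a signed_graph \<Rightarrow> nat" where
  "num_pos_marked G = card {v \<in> nodes G. canonical_marking G v = 1}"

definition num_neg_marked :: "'a signed_graph \<Rightarrow> nat" where
  "num_neg_marked G = card {v \<in> nodes G. canonical_marking G v = -1}"

text \<open>In the corona product, \<open>Inl u\<close> is the node \<open>u\<close> of \<open>H1\<close>, and \<open>Inr (u, w)\<close> is the node \<open>w\<close>
  in the copy of \<open>H2\<close> attached to \<open>u\<close>. An edge inside \<open>H1\<close> or inside a copy of \<open>H2\<close> keeps its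
  sign; the last branch of \<open>edge_sign\<close> applies to an edge \<open>{Inl u, Inr (u, w)}\<close>, for which the
  product over the two endpoints is \<open>canonical_marking H1 u * canonical_marking H2 w\<close>.\<close>

definition corona :: "'a signed_graph \<Rightarrow> 'b signed_graph \<Rightarrow> ('a + 'a \<times> 'b) signed_graph" where
  "corona H1 H2 = \<lparr>
     nodes = Inl ` nodes H1 \<union> Inr ` (nodes H1 \<times> nodes H2),
     edges = {Inl ` e | e. e \<in> edges H1}
       \<union> {(\<lambda>w. Inr (u, w)) ` e | u e. u \<in> nodes H1 \<and> e \<in> edges H2}
       \<union> {{Inl u, Inr (u, w)} | u w. u \<in> nodes H1 \<and> w \<in> nodes H2},
     edge_sign = (\<lambda>e.
       if e \<subseteq> range Inl then edge_sign H1 {u. Inl u \<in> e}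
       else if e \<subseteq> range Inr then edge_sign H2 {w. \<exists>u. Inr (u, w) \<in> e}
       else \<Prod>x\<in>e. (case x of Inl u \<Rightarrow> canonical_marking H1 u
                             | Inr (u, w) \<Rightarrow> canonical_marking H2 w)) \<rparr>"

text \<open>Renaming the nodes along a map that is injective on the nodes gives an isomorphic copy.\<close>

definition relabel :: "('a \<Rightarrow> 'b) \<Rightarrow> 'a signed_graph \<Rightarrow> 'b signed_graph" where
  "relabel f G = \<lparr>
     nodes = f ` nodes G,
     edges = (`) f ` edges G,
     edge_sign = (\<lambda>e. edge_sign G {x \<in> nodes G. f x \<in> e}) \<rparr>"

text \<open>The iterated coronas need one node type for all \<open>m\<close>. \<open>Seed v\<close> is the node \<open>v\<close> of the seed
  graph, and \<open>Copy m u w\<close> is the node \<open>w\<close> in the copy of the seed graph that is attached to the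
  node \<open>u\<close> at step \<open>m\<close>; the step index keeps copies attached to the same node at different
  steps apart. With this naming the nodes of each corona graph are literally nodes of the next.\<close>

datatype 'a corona_node = Seed 'a | Copy nat "'a corona_node" 'a

fun attach :: "nat \<Rightarrow> 'a corona_node + 'a corona_node \<times> 'a \<Rightarrow> 'a corona_node" where
  "attach m (Inl u) = u"
| "attach m (Inr (u, w)) = Copy m u w"

primrec corona_graph :: "'a signed_graph \<Rightarrow> nat \<Rightarrow> 'a corona_node signed_graph" where
  "corona_graph G 0 = relabel Seed G"
| "corona_graph G (Suc m) = relabel (attach (Suc m)) (corona (corona_graph G m) G)"

lemma nodes_corona_graph:
  "nodes (corona_graph G 0) = Seed ` nodes G"
  "nodes (corona_graph G (Suc m)) = nodes (corona_graph G m)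
     \<union> {Copy (Suc m) u w | u w. u \<in> nodes (corona_graph G m) \<and> w \<in> nodes G}"
  by (auto simp: relabel_def corona_def image_Un image_image) force

lemma Copy_step_le: "Copy k u w \<in> nodes (corona_graph G m) \<Longrightarrow> k \<le> m"
  by (induction m) (auto simp: nodes_corona_graph simp del: corona_graph.simps)

lemma inj_on_attach:
  "inj_on (attach (Suc m)) (nodes (corona (corona_graph G m) G))"
proof -
  have no: "Copy (Suc m) u w \<notin> nodes (corona_graph G m)" for u w
    using Copy_step_le[of "Suc m" u w G m] by auto
  then show ?thesis
    by (fastforce simp: inj_on_def corona_def)
qed

lemma Seed_in_corona_graph:
  "v \<in> nodes G \<Longrightarrow> Seed v \<in> nodes (corona_graph G m)"
  by (induction m) (auto simp: nodes_corona_graph simp del: corona_graph.simps)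

lemma wf_relabel:
  assumes "wf_signed_graph G" and "inj_on f (nodes G)"
  shows "wf_signed_graph (relabel f G)"
proof -
  have "{x \<in> nodes G. f x \<in> f ` e} = e" if "e \<in> edges G" for e
    using assms that by (auto simp: wf_signed_graph_def inj_on_def)
  moreover have "card (f ` e) = 2" if "e \<in> edges G" for e
    using assms that by (metis card_image inj_on_subset wf_signed_graph_def)
  ultimately show ?thesis
    using assms(1) by (auto simp: wf_signed_graph_def relabel_def image_mono)
qed

lemma canonical_marking_cases:
  assumes "wf_signed_graph G"
  shows "canonical_marking G v = 1 \<or> canonical_marking G v = -1"
proof -
  have prod_abs: "\<bar>\<Prod>e\<in>F. edge_sign G e\<bar> = 1" if "\<forall>e\<in>F. \<bar>edge_sign G e\<bar> = 1" for F
    using that by (induction F rule: infinite_finite_induct) (simp_all add: abs_mult)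
  have "\<forall>e \<in> {e \<in> edges G. v \<in> e}. \<bar>edge_sign G e\<bar> = 1"
    using assms unfolding wf_signed_graph_def by fastforce
  from prod_abs[OF this] have "\<bar>canonical_marking G v\<bar> = 1"
    unfolding canonical_marking_def .
  then show ?thesis
    by linarith
qed

lemma corona_sign_join:
  "edge_sign (corona H1 H2) {Inl u, Inr (u, w)} = canonical_marking H1 u * canonical_marking H2 w"
  by (auto simp: corona_def)

lemma corona_sign_base:
  fixes H1 :: "'a signed_graph" and H2 :: "'b signed_graph"
  shows "edge_sign (corona H1 H2) (Inl ` e) = edge_sign H1 e"
proof -
  have "{v. (Inl v :: 'a + 'a \<times> 'b) \<in> Inl ` e} = e"
    by auto
  moreover have "(Inl ` e :: ('a + 'a \<times> 'b) set) \<subseteq> range Inl"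
    by auto
  ultimately show ?thesis
    by (simp add: corona_def)
qed

lemma corona_sign_copy:
  fixes H1 :: "'a signed_graph" and H2 :: "'b signed_graph"
  assumes "e \<noteq> {}"
  shows "edge_sign (corona H1 H2) ((\<lambda>w. Inr (u, w)) ` e) = edge_sign H2 e"
proof -
  have "{w. \<exists>u'. (Inr (u', w) :: 'a + 'a \<times> 'b) \<in> (\<lambda>w. Inr (u, w)) ` e} = e"
    by auto
  moreover have "((\<lambda>w. Inr (u, w)) ` e :: ('a + 'a \<times> 'b) set) \<subseteq> range Inr"
    by auto
  moreover have "\<not> ((\<lambda>w. Inr (u, w)) ` e :: ('a + 'a \<times> 'b) set) \<subseteq> range Inl"
    using assms by auto
  ultimately show ?thesis
    by (simp add: corona_def)
qed

lemma wf_corona: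
  assumes 1: "wf_signed_graph H1" and 2: "wf_signed_graph H2"
  shows "wf_signed_graph (corona H1 H2)"
proof -
  have "e \<subseteq> nodes (corona H1 H2) \<and> card e = 2
      \<and> (edge_sign (corona H1 H2) e = 1 \<or> edge_sign (corona H1 H2) e = -1)"
    if "e \<in> edges (corona H1 H2)" for e
  proof -
    from that consider (base) f where "e = Inl ` f" "f \<in> edges H1"
      | (copy) u f where "e = (\<lambda>w. Inr (u, w)) ` f" "u \<in> nodes H1" "f \<in> edges H2"
      | (join) u w where "e = {Inl u, Inr (u, w)}" "u \<in> nodes H1" "w \<in> nodes H2"
      unfolding corona_def by auto
    then show ?thesis
    proof cases
      case base
      then have "card e = 2"
        using 1 by (simp add: wf_signed_graph_def card_image)
      moreover have "e \<subseteq> nodes (corona H1 H2)"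
        using 1 base by (fastforce simp: corona_def wf_signed_graph_def)
      moreover have "edge_sign H1 f = 1 \<or> edge_sign H1 f = -1"
        using 1 base by (simp add: wf_signed_graph_def)
      ultimately show ?thesis
        unfolding base(1) corona_sign_base by blast
    next
      case copy
      then have "f \<noteq> {}" and "card f = 2"
        using 2 by (auto simp: wf_signed_graph_def)
      moreover have "card e = card f"
        unfolding copy(1) by (rule card_image) (auto simp: inj_on_def)
      moreover have "e \<subseteq> nodes (corona H1 H2)"
        using 2 copy by (fastforce simp: corona_def wf_signed_graph_def)
      moreover have "edge_sign H2 f = 1 \<or> edge_sign H2 f = -1"
        using 2 copy by (simp add: wf_signed_graph_def)
      ultimately show ?thesis
        unfolding copy(1) by (simp add: corona_sign_copy)
    next
      case join
      moreover have "e \<subseteq> nodes (corona H1 H2)"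
        using join by (auto simp: corona_def)
      ultimately show ?thesis
        using canonical_marking_cases[OF 1, of u] canonical_marking_cases[OF 2, of w]
        by (auto simp: corona_sign_join)
    qed
  qed
  moreover have "finite (nodes (corona H1 H2))"
    using 1 2 by (auto simp: corona_def wf_signed_graph_def)
  ultimately show ?thesis
    by (auto simp: wf_signed_graph_def)
qed

lemma wf_corona_graph:
  "wf_signed_graph G \<Longrightarrow> wf_signed_graph (corona_graph G m)"
  by (induction m)
    (simp_all add: wf_relabel wf_corona inj_on_attach inj_on_def[of Seed])

end

theory Submission
  imports Defs
begin

text \<open>Each corona step joins a node of current marking \<open>s\<close> to each node \<open>w\<close> of one new copy of
  \<open>G\<close> by an edge of sign \<open>s * \<mu>(w)\<close>. With \<open>a\<close> the number of nodes of \<open>G\<close> of marking \<open>s\<close> and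
  \<open>b\<close> the number of the others, the positive and negative degrees therefore grow by
  \<open>a\<close> and \<open>b\<close>, and the marking flips iff \<open>b\<close> is odd. After a flip the roles of \<open>a\<close> and \<open>b\<close> are
  exchanged, so the marking is constant if \<open>b\<close> is even, flips exactly once if \<open>b\<close> is odd
  and \<open>a\<close> even, and alternates if both are odd.\<close>

text \<open>The sign is a parameter so that positive and negative degrees are treated by one
  argument; a flip of the marking then becomes a negation of this parameter.\<close>

definition sign_degree :: "int \<Rightarrow> 'a signed_graph \<Rightarrow> 'a \<Rightarrow> nat" where
  "sign_degree s G v = card {e \<in> edges G. v \<in> e \<and> edge_sign G e = s}"

definition num_marked :: "int \<Rightarrow> 'a signed_graph \<Rightarrow> nat" where
  "num_marked s G = card {v \<in> nodes G. canonical_marking G v = s}"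

lemma pos_degree_eq: "pos_degree G v = sign_degree 1 G v"
  by (simp add: pos_degree_def sign_degree_def)

lemma neg_degree_eq: "neg_degree G v = sign_degree (-1) G v"
  by (simp add: neg_degree_def sign_degree_def)

lemma num_pos_marked_eq: "num_pos_marked G = num_marked 1 G"
  by (simp add: num_pos_marked_def num_marked_def)

lemma num_neg_marked_eq: "num_neg_marked G = num_marked (-1) G"
  by (simp add: num_neg_marked_def num_marked_def)

lemma finite_edges:
  assumes "wf_signed_graph G"
  shows "finite (edges G)"
proof (rule finite_subset)
  show "edges G \<subseteq> Pow (nodes G)"
    using assms by (auto simp: wf_signed_graph_def)
  show "finite (Pow (nodes G))"
    using assms by (simp add: wf_signed_graph_def)
qed

text \<open>Only the negative edges contribute a factor other than 1. Every later statement on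
  markings is obtained from one on negative degrees in this way.\<close>

lemma canonical_marking_eq_power:
  assumes "wf_signed_graph G"
  shows "canonical_marking G v = (-1) ^ neg_degree G v"
proof -
  let ?E = "{e \<in> edges G. v \<in> e}"
  have "canonical_marking G v = (\<Prod>e\<in>?E. if edge_sign G e = -1 then -1 else 1)"
    unfolding canonical_marking_def
    using assms by (intro prod.cong) (auto simp: wf_signed_graph_def)
  also have "\<dots> = (\<Prod>e\<in>{e \<in> ?E. edge_sign G e = -1}. -1)"
    using finite_edges[OF assms] by (intro prod.inter_filter[symmetric]) simp
  also have "\<dots> = (-1) ^ neg_degree G v"
    by (simp add: neg_degree_def conj_assoc)
  finally show ?thesis .
qed

text \<open>Taking images under \<open>f\<close> is a sign-preserving bijection between the edges at
  \<open>v\<close> and those at \<open>f v\<close>; edges are sets of nodes, so injectivity on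
  \<open>nodes G\<close> suffices.\<close>

lemma sign_degree_relabel:
  assumes "wf_signed_graph G" and inj: "inj_on f (nodes G)" and v: "v \<in> nodes G"
  shows "sign_degree s (relabel f G) (f v) = sign_degree s G v"
proof -
  have sub: "e \<subseteq> nodes G" if "e \<in> edges G" for e
    using assms(1) that by (simp add: wf_signed_graph_def)
  have sgn: "edge_sign (relabel f G) (f ` e) = edge_sign G e" if "e \<in> edges G" for e
  proof -
    have "{x \<in> nodes G. f x \<in> f ` e} = e"
      using sub[OF that] inj by (auto simp: inj_on_def)
    then show ?thesis
      by (simp add: relabel_def)
  qed
  have mem: "f v \<in> f ` e \<longleftrightarrow> v \<in> e" if "e \<in> edges G" for e
    using inj_on_image_mem_iff[OF inj v sub[OF that]] .
  have "{e \<in> edges (relabel f G). f v \<in> e \<and> edge_sign (relabel f G) e = s}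
      = (`) f ` {e \<in> edges G. v \<in> e \<and> edge_sign G e = s}" (is "?L = _ ` ?R")
  proof -
    have "?L = (`) f ` {e \<in> edges G. f v \<in> f ` e \<and> edge_sign (relabel f G) (f ` e) = s}"
      by (auto simp: relabel_def)
    also have "\<dots> = (`) f ` ?R"
      by (simp add: sgn mem cong: conj_cong)
    finally show ?thesis .
  qed
  moreover have "inj_on ((`) f) ?R"
    using inj_on_image_Pow[OF inj] by (rule inj_on_subset) (use sub in auto)
  ultimately show ?thesis
    by (simp add: sign_degree_def card_image)
qed

lemma canonical_marking_relabel:
  assumes "wf_signed_graph G" and "inj_on f (nodes G)" and "v \<in> nodes G"
  shows "canonical_marking (relabel f G) (f v) = canonical_marking G v"
  using assms
  by (simp add: canonical_marking_eq_power wf_relabel neg_degree_eq sign_degree_relabel)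

text \<open>Besides its old edges, \<open>Inl v\<close> meets exactly the edges that join it to its
  own copy of \<open>H2\<close>.\<close>

lemma sign_degree_corona:
  assumes wf: "wf_signed_graph H1" "wf_signed_graph H2" and v: "v \<in> nodes H1"
  shows "sign_degree s (corona H1 H2) (Inl v)
    = sign_degree s H1 v + num_marked (canonical_marking H1 v * s) H2"
proof -
  let ?C = "corona H1 H2" and ?\<mu> = "canonical_marking H1 v"
  let ?join = "\<lambda>w. {Inl v, Inr (v, w)}"
  let ?E1 = "{e \<in> edges H1. v \<in> e \<and> edge_sign H1 e = s}"
  let ?W = "{w \<in> nodes H2. canonical_marking H2 w = ?\<mu> * s}"
  have edges: "edges ?C = {Inl ` e | e. e \<in> edges H1}
      \<union> {(\<lambda>w. Inr (u, w)) ` e | u e. u \<in> nodes H1 \<and> e \<in> edges H2}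
      \<union> {{Inl u, Inr (u, w)} | u w. u \<in> nodes H1 \<and> w \<in> nodes H2}"
    by (simp add: corona_def)
  \<comment> \<open>Multiplying by \<open>?\<mu>\<close> solves for the marking of \<open>w\<close>,
    since \<open>?\<mu>\<close> is 1 or -1 and so its own inverse.\<close>
  have join_sign: "edge_sign ?C (?join w) = s \<longleftrightarrow> canonical_marking H2 w = ?\<mu> * s" for w
    using canonical_marking_cases[OF wf(1), of v] by (auto simp: corona_sign_join)
  have "{e \<in> edges ?C. Inl v \<in> e \<and> edge_sign ?C e = s} = (`) Inl ` ?E1 \<union> ?join ` ?W"
    (is "?L = ?R")
  proof (intro equalityI subsetI)
    fix e assume "e \<in> ?L"
    then have sgn: "edge_sign ?C e = s"
      \<comment> \<open>Edges inside a copy consist of \<open>Inr\<close> nodes and drop out; a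
        joining edge through \<open>Inl v\<close> must have \<open>u = v\<close>.\<close>
      and "(\<exists>f \<in> edges H1. e = Inl ` f \<and> v \<in> f) \<or> (\<exists>w \<in> nodes H2. e = ?join w)"
      unfolding edges by auto
    then consider f where "f \<in> edges H1" "e = Inl ` f" "v \<in> f"
      | w where "w \<in> nodes H2" "e = ?join w"
      by blast
    then show "e \<in> ?R"
    proof cases
      case 1
      then show ?thesis
        using sgn by (simp add: corona_sign_base)
    next
      case 2
      then show ?thesis
        using sgn join_sign by blast
    qed
  next
    fix e assume "e \<in> ?R"
    then show "e \<in> ?L"
      unfolding edges using v by (auto simp: corona_sign_base join_sign)
  qed
  moreover have "card ((`) Inl ` ?E1 :: ('a + 'a \<times> 'b) set set) = card ?E1"
    by (rule card_image) (auto simp: inj_on_def inj_image_eq_iff)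
  moreover have "card (?join ` ?W) = card ?W"
    by (rule card_image) (auto simp: inj_on_def doubleton_eq_iff)
  moreover have "(`) Inl ` ?E1 \<inter> ?join ` ?W = {}"
    by auto
  moreover have "finite ?E1" and "finite ?W"
    using finite_edges[OF wf(1)] wf(2) by (auto simp: wf_signed_graph_def)
  ultimately show ?thesis
    unfolding sign_degree_def num_marked_def by (simp add: card_Un_disjoint)
qed

lemma sign_degree_corona_graph_0:
  assumes "wf_signed_graph G" and "v \<in> nodes G"
  shows "sign_degree s (corona_graph G 0) (Seed v) = sign_degree s G v"
  using assms by (simp add: sign_degree_relabel inj_on_def)

lemma canonical_marking_corona_graph_0:
  assumes "wf_signed_graph G" and "v \<in> nodes G"
  shows "canonical_marking (corona_graph G 0) (Seed v) = canonical_marking G v"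
  using assms by (simp add: canonical_marking_relabel inj_on_def)

text \<open>\<open>attach\<close> sends \<open>Inl x\<close> to \<open>x\<close>, so old nodes keep
  their names and the count in the corona survives the relabelling.\<close>

lemma sign_degree_corona_graph_Suc:
  assumes wf: "wf_signed_graph G" and x: "x \<in> nodes (corona_graph G m)"
  shows "sign_degree s (corona_graph G (Suc m)) x = sign_degree s (corona_graph G m) x
    + num_marked (canonical_marking (corona_graph G m) x * s) G"
proof -
  note wfm = wf_corona_graph[OF wf]
  have "Inl x \<in> nodes (corona (corona_graph G m) G)"
    using x by (simp add: corona_def)
  from sign_degree_relabel[OF wf_corona[OF wfm wf] inj_on_attach this]
  show ?thesis
    by (simp add: sign_degree_corona[OF wfm wf x])
qed

text \<open>The exponent is the increment of the negative degree. With the degree recurrence this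
  gives a closed system for the degrees and the marking of a node.\<close>

lemma canonical_marking_corona_graph_Suc:
  assumes wf: "wf_signed_graph G" and x: "x \<in> nodes (corona_graph G m)"
  shows "canonical_marking (corona_graph G (Suc m)) x = canonical_marking (corona_graph G m) x
    * (-1) ^ num_marked (- canonical_marking (corona_graph G m) x) G"
  unfolding canonical_marking_eq_power[OF wf_corona_graph[OF wf]] neg_degree_eq
    sign_degree_corona_graph_Suc[OF assms]
  by (simp add: power_add)

text \<open>Counting relative to the initial marking \<open>s\<close> handles both markings of
  \<open>v\<close> together and leaves three parity patterns of \<open>a\<close> and
  \<open>b\<close>.\<close>

lemma corona_graph_degrees:
  fixes G :: "'a signed_graph" and s :: int
  assumes wf: "wf_signed_graph G" and v: "v \<in> nodes G"
  defines "s \<equiv> canonical_marking G v"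
  defines "a \<equiv> num_marked s G" and "b \<equiv> num_marked (- s) G"
  defines "p \<equiv> \<lambda>m. pos_degree (corona_graph G m) (Seed v)"
    and "q \<equiv> \<lambda>m. neg_degree (corona_graph G m) (Seed v)"
  shows corona_graph_degrees_even:
      "even b \<Longrightarrow> p m = pos_degree G v + m * a \<and> q m = neg_degree G v + m * b"
    and corona_graph_degrees_odd_even:
      "odd b \<Longrightarrow> even a \<Longrightarrow> m \<ge> 1 \<Longrightarrow>
        p m = pos_degree G v + a + (m - 1) * b \<and> q m = neg_degree G v + b + (m - 1) * a"
    and corona_graph_degrees_odd_odd:
      "odd b \<Longrightarrow> odd a \<Longrightarrow>
        p m = pos_degree G v + (m + 1) div 2 * a + m div 2 * b \<and>
        q m = neg_degree G v + (m + 1) div 2 * b + m div 2 * a"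
proof -
  let ?\<mu> = "\<lambda>m. canonical_marking (corona_graph G m) (Seed v)"
  have p0: "p 0 = pos_degree G v" and q0: "q 0 = neg_degree G v" and \<mu>0: "?\<mu> 0 = s"
    using sign_degree_corona_graph_0[OF wf v] canonical_marking_corona_graph_0[OF wf v]
    by (simp_all add: p_def q_def s_def pos_degree_eq neg_degree_eq del: corona_graph.simps)
  have pS: "p (Suc m) = p m + num_marked (?\<mu> m) G"
    and qS: "q (Suc m) = q m + num_marked (- ?\<mu> m) G" for m
    using sign_degree_corona_graph_Suc[OF wf Seed_in_corona_graph[OF v]]
    by (simp_all add: p_def q_def pos_degree_eq neg_degree_eq del: corona_graph.simps)
  have \<mu>S: "?\<mu> (Suc m) = ?\<mu> m * (-1) ^ num_marked (- ?\<mu> m) G" for m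
    by (rule canonical_marking_corona_graph_Suc[OF wf Seed_in_corona_graph[OF v]])
  note [simp del] = corona_graph.simps
  note [simp] = p0 q0 \<mu>0 pS qS \<mu>S a_def[symmetric] b_def[symmetric]

  show "p m = pos_degree G v + m * a \<and> q m = neg_degree G v + m * b" if "even b"
  proof -
    have "?\<mu> m = s" for m
      using that by (induction m) simp_all
    then show ?thesis
      by (induction m) simp_all
  qed
  show "p m = pos_degree G v + a + (m - 1) * b \<and> q m = neg_degree G v + b + (m - 1) * a"
    if "odd b" "even a" "m \<ge> 1"
  proof -
    \<comment> \<open>The base case uses that \<open>b\<close> is odd. Afterwards the exponent is
      \<open>a\<close>, which is even, so no further flip occurs.\<close>
    have "?\<mu> (Suc k) = - s" for k
      using that by (induction k) simp_all
    then have "p (Suc k) = pos_degree G v + a + k * b \<and> q (Suc k) = neg_degree G v + b + k * a"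
      for k
      \<comment> \<open>Without \<open>\<mu>S\<close>, the closed form just proved rewrites
        \<open>?\<mu> (Suc k)\<close> instead of the recurrence unfolding it.\<close>
      by (induction k) (simp_all del: \<mu>S)
    \<comment> \<open>At \<open>m = 0\<close> the truncated \<open>m - 1\<close> would leave
      spurious summands \<open>a\<close> and \<open>b\<close>, hence
      \<open>m \<ge> 1\<close>.\<close>
    from this[of "m - 1"] show ?thesis
      using that by simp
  qed
  show "p m = pos_degree G v + (m + 1) div 2 * a + m div 2 * b \<and>
      q m = neg_degree G v + (m + 1) div 2 * b + m div 2 * a"
    if "odd b" "odd a"
  proof -
    \<comment> \<open>Among the indices below \<open>m\<close>, \<open>(m + 1) div 2\<close> are
      even and contribute with marking \<open>s\<close>; the \<open>m div 2\<close> odd ones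
      contribute with \<open>- s\<close>.\<close>
    have "?\<mu> m = (if even m then s else - s)" for m
      using that by (induction m) simp_all
    then show ?thesis
      by (induction m) (simp_all del: \<mu>S)
  qed
qed

theorem theorem5:
  fixes G :: "'a signed_graph" and v :: 'a and m np nm :: nat
  assumes "wf_signed_graph G"
    and "card (nodes G) > 1"
    and "np = num_pos_marked G"
    and "nm = num_neg_marked G"
    and "m \<ge> 1"
    and "v \<in> nodes G"
  shows
    "(odd np \<and> odd nm \<longrightarrow>
        (even m \<longrightarrow>
           pos_degree (corona_graph G m) (Seed v) = pos_degree G v + m div 2 * (np + nm) \<and>
           neg_degree (corona_graph G m) (Seed v) = neg_degree G v + m div 2 * (np + nm)) \<and>
        (odd m \<and> canonical_marking G v = 1 \<longrightarrow>
           pos_degree (corona_graph G m) (Seed v)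
             = pos_degree G v + (m + 1) div 2 * np + (m - 1) div 2 * nm \<and>
           neg_degree (corona_graph G m) (Seed v)
             = neg_degree G v + (m + 1) div 2 * nm + (m - 1) div 2 * np) \<and>
        (odd m \<and> canonical_marking G v = -1 \<longrightarrow>
           pos_degree (corona_graph G m) (Seed v)
             = pos_degree G v + (m + 1) div 2 * nm + (m - 1) div 2 * np \<and>
           neg_degree (corona_graph G m) (Seed v)
             = neg_degree G v + (m + 1) div 2 * np + (m - 1) div 2 * nm))
     \<and>
     (even np \<and> odd nm \<longrightarrow>
        (canonical_marking G v = 1 \<longrightarrow>
           pos_degree (corona_graph G m) (Seed v) = pos_degree G v + np + (m - 1) * nm \<and>
           neg_degree (corona_graph G m) (Seed v) = neg_degree G v + nm + (m - 1) * np) \<and>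
        (canonical_marking G v = -1 \<longrightarrow>
           pos_degree (corona_graph G m) (Seed v) = pos_degree G v + m * nm \<and>
           neg_degree (corona_graph G m) (Seed v) = neg_degree G v + m * np))
     \<and>
     (even np \<and> even nm \<longrightarrow>
        (canonical_marking G v = 1 \<longrightarrow>
           pos_degree (corona_graph G m) (Seed v) = pos_degree G v + m * np \<and>
           neg_degree (corona_graph G m) (Seed v) = neg_degree G v + m * nm) \<and>
        (canonical_marking G v = -1 \<longrightarrow>
           pos_degree (corona_graph G m) (Seed v) = pos_degree G v + m * nm \<and>
           neg_degree (corona_graph G m) (Seed v) = neg_degree G v + m * np))
     \<and>
     (odd np \<and> even nm \<longrightarrow>
        (canonical_marking G v = 1 \<longrightarrow>
           pos_degree (corona_graph G m) (Seed v) = pos_degree G v + m * np \<and>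
           neg_degree (corona_graph G m) (Seed v) = neg_degree G v + m * nm) \<and>
        (canonical_marking G v = -1 \<longrightarrow>
           pos_degree (corona_graph G m) (Seed v) = pos_degree G v + nm + (m - 1) * np \<and>
           neg_degree (corona_graph G m) (Seed v) = neg_degree G v + np + (m - 1) * nm))"
proof -
  note wf = assms(1) and v = assms(6)
  note degs = corona_graph_degrees_even[OF wf v, of m]
    corona_graph_degrees_odd_even[OF wf v, of m] corona_graph_degrees_odd_odd[OF wf v, of m]
  have np: "num_marked 1 G = np" and nm: "num_marked (-1) G = nm"
    using assms(3,4) by (simp_all add: num_pos_marked_eq num_neg_marked_eq)
  \<comment> \<open>This matches \<open>m div 2\<close> in the alternating pattern with
    \<open>(m - 1) div 2\<close> in the goal; the simplifier writes 1 as
    \<open>Suc 0\<close>.\<close>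
  have half: "(m - Suc 0) div 2 = m div 2" if "odd m"
    using that by (auto elim: oddE)
  consider "canonical_marking G v = 1" | "canonical_marking G v = -1"
    using canonical_marking_cases[OF wf] by blast
  then show ?thesis
  proof cases
    case 1
    show ?thesis
      using degs assms(5) by (simp add: 1 np nm half algebra_simps)
  next
    \<comment> \<open>Here \<open>a\<close> is \<open>nm\<close> and \<open>b\<close> is
      \<open>np\<close>, so the two mixed-parity cases exchange their patterns compared with marking
      1.\<close>
    case 2
    show ?thesis
      using degs assms(5) by (simp add: 2 np nm half algebra_simps)
  qed
qed

end
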